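(* Let $A=(a_{ij})_{i,j=1}^n$ be a quaternionic $n\times n$ matrix, and let $M_{pq}$ denote the matrix obtained from $A$ by deleting the $p$-th row and the $q$-th column. Then $$D(A)\le \sum_{i=1}^n |a_{1i}|\, D(M_{1i}).$$ Similar inequalities hold for any other row or column, that is, for every $p\in\{1,\dots,n\}$, $$D(A)\le \sum_{i=1}^n |a_{pi}|\, D(M_{pi}) \quad\text{and}\quad D(A)\le \sum_{i=1}^n |a_{ip}|\, D(M_{ip}).$$
   Context: $\mathbb{H}$ is the skew field of quaternions, $\bar q$ the quaternionic conjugate, $|q|=\sqrt{q\bar q}$. The Dieudonné determinant $D:M_n(\mathbb{H})\to\mathbb{R}_{\ge 0}$ is defined as follows: $D(X)=0$ if $X$ is not invertible; on $GL_n(\mathbb{H})$, $D$ is the unique group homomorphism to $\mathbb{R}_{>0}$ that is trivial on all elementary matrices (matrices with ones on the diagonal and at most one non-zero off-diagonal entry) and satisfies $D(\mathrm{diag}(x_1,\dots,x_n))=\prod_i|x_i|$ for invertible diagonal matrices. For $n=1$, $D(x)=|x|$; the empty matrix has $D=1$. *)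

theory Defs
  imports
    "HOL-Analysis.Product_Vector"
    "Jordan_Normal_Form.Determinant"
begin

section \<open>Quaternions\<close>

text \<open>\<open>Quat a b c d\<close> is $a + b i + c j + d k$ with $i^2 = j^2 = k^2 = ijk = -1$.\<close>

datatype quat = Quat (qRe: real) (qIm1: real) (qIm2: real) (qIm3: real)

lemma quat_eq_iff:
  "x = y \<longleftrightarrow> qRe x = qRe y \<and> qIm1 x = qIm1 y \<and> qIm2 x = qIm2 y \<and> qIm3 x = qIm3 y"
  by (cases x; cases y) auto

definition qcnj :: "quat \<Rightarrow> quat" where
  "qcnj q = Quat (qRe q) (- qIm1 q) (- qIm2 q) (- qIm3 q)"

lemma qcnj_simps [simp]:
  "qRe (qcnj q) = qRe q" "qIm1 (qcnj q) = - qIm1 q"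
  "qIm2 (qcnj q) = - qIm2 q" "qIm3 (qcnj q) = - qIm3 q"
  by (simp_all add: qcnj_def)

instantiation quat :: real_vector
begin

definition zero_quat :: quat where
  "0 = Quat 0 0 0 0"
definition plus_quat :: "quat \<Rightarrow> quat \<Rightarrow> quat" where
  "x + y = Quat (qRe x + qRe y) (qIm1 x + qIm1 y) (qIm2 x + qIm2 y) (qIm3 x + qIm3 y)"
definition uminus_quat :: "quat \<Rightarrow> quat" where
  "- x = Quat (- qRe x) (- qIm1 x) (- qIm2 x) (- qIm3 x)"
definition minus_quat :: "quat \<Rightarrow> quat \<Rightarrow> quat" where
  "x - y = Quat (qRe x - qRe y) (qIm1 x - qIm1 y) (qIm2 x - qIm2 y) (qIm3 x - qIm3 y)"
definition scaleR_quat :: "real \<Rightarrow> quat \<Rightarrow> quat" where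
  "r *\<^sub>R x = Quat (r * qRe x) (r * qIm1 x) (r * qIm2 x) (r * qIm3 x)"

instance
  by standard
    (simp_all add: zero_quat_def plus_quat_def uminus_quat_def minus_quat_def scaleR_quat_def
      quat_eq_iff algebra_simps)

end

lemma quat_linear_simps [simp]:
  "qRe 0 = 0" "qIm1 0 = 0" "qIm2 0 = 0" "qIm3 0 = 0"
  "qRe (x + y) = qRe x + qRe y" "qIm1 (x + y) = qIm1 x + qIm1 y"
  "qIm2 (x + y) = qIm2 x + qIm2 y" "qIm3 (x + y) = qIm3 x + qIm3 y"
  "qRe (- x) = - qRe x" "qIm1 (- x) = - qIm1 x"
  "qIm2 (- x) = - qIm2 x" "qIm3 (- x) = - qIm3 x"
  "qRe (x - y) = qRe x - qRe y" "qIm1 (x - y) = qIm1 x - qIm1 y"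
  "qIm2 (x - y) = qIm2 x - qIm2 y" "qIm3 (x - y) = qIm3 x - qIm3 y"
  "qRe (r *\<^sub>R x) = r * qRe x" "qIm1 (r *\<^sub>R x) = r * qIm1 x"
  "qIm2 (r *\<^sub>R x) = r * qIm2 x" "qIm3 (r *\<^sub>R x) = r * qIm3 x"
  by (simp_all add: zero_quat_def plus_quat_def uminus_quat_def minus_quat_def scaleR_quat_def)

instantiation quat :: real_algebra_1
begin

definition one_quat :: quat where
  "1 = Quat 1 0 0 0"
definition times_quat :: "quat \<Rightarrow> quat \<Rightarrow> quat" where
  "x * y = Quat
     (qRe x * qRe y - qIm1 x * qIm1 y - qIm2 x * qIm2 y - qIm3 x * qIm3 y)
     (qRe x * qIm1 y + qIm1 x * qRe y + qIm2 x * qIm3 y - qIm3 x * qIm2 y)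
     (qRe x * qIm2 y - qIm1 x * qIm3 y + qIm2 x * qRe y + qIm3 x * qIm1 y)
     (qRe x * qIm3 y + qIm1 x * qIm2 y - qIm2 x * qIm1 y + qIm3 x * qRe y)"

instance
  by standard (simp_all add: one_quat_def times_quat_def quat_eq_iff algebra_simps)

end

lemma quat_ring_simps [simp]:
  "qRe 1 = 1" "qIm1 1 = 0" "qIm2 1 = 0" "qIm3 1 = 0"
  "qRe (x * y) = qRe x * qRe y - qIm1 x * qIm1 y - qIm2 x * qIm2 y - qIm3 x * qIm3 y"
  "qIm1 (x * y) = qRe x * qIm1 y + qIm1 x * qRe y + qIm2 x * qIm3 y - qIm3 x * qIm2 y"
  "qIm2 (x * y) = qRe x * qIm2 y - qIm1 x * qIm3 y + qIm2 x * qRe y + qIm3 x * qIm1 y"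
  "qIm3 (x * y) = qRe x * qIm3 y + qIm1 x * qIm2 y - qIm2 x * qIm1 y + qIm3 x * qRe y"
  by (simp_all add: one_quat_def times_quat_def)

definition qnorm_sq :: "quat \<Rightarrow> real" where
  "qnorm_sq q = (qRe q)\<^sup>2 + (qIm1 q)\<^sup>2 + (qIm2 q)\<^sup>2 + (qIm3 q)\<^sup>2"

lemma qnorm_sq_nonneg: "0 \<le> qnorm_sq q"
  by (simp add: qnorm_sq_def)

lemma qnorm_sq_eq_0_iff: "qnorm_sq q = 0 \<longleftrightarrow> q = 0"
  by (auto simp: qnorm_sq_def quat_eq_iff add_nonneg_eq_0_iff)

lemma qnorm_sq_mult: "qnorm_sq (x * y) = qnorm_sq x * qnorm_sq y"
  by (simp add: qnorm_sq_def power2_eq_square algebra_simps)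

lemma quat_mult_qcnj: "q * qcnj q = of_real (qnorm_sq q)"
  by (simp add: qnorm_sq_def of_real_def quat_eq_iff power2_eq_square)

lemma qcnj_mult_quat: "qcnj q * q = of_real (qnorm_sq q)"
  by (simp add: qnorm_sq_def of_real_def quat_eq_iff power2_eq_square)

text \<open>By the last two lemmas $q \bar q$ is a nonnegative real, so that the norm
  defined here is $|q| = \sqrt{q \bar q}$.\<close>

instantiation quat :: real_normed_div_algebra
begin

definition norm_quat :: "quat \<Rightarrow> real" where
  "norm q = sqrt (qRe (q * qcnj q))"
definition sgn_quat :: "quat \<Rightarrow> quat" where
  "sgn (x :: quat) = x /\<^sub>R norm x"
definition dist_quat :: "quat \<Rightarrow> quat \<Rightarrow> real" where
  "dist (x :: quat) y = norm (x - y)"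
definition uniformity_quat :: "(quat \<times> quat) filter" where
  "uniformity = (INF e\<in>{0 <..}. principal {(x :: quat, y). dist x y < e})"
definition open_quat :: "quat set \<Rightarrow> bool" where
  "open (U :: quat set) \<longleftrightarrow> (\<forall>x\<in>U. eventually (\<lambda>(x', y). x' = x \<longrightarrow> y \<in> U) uniformity)"
definition inverse_quat :: "quat \<Rightarrow> quat" where
  "inverse q = qcnj q /\<^sub>R (norm q)\<^sup>2"
definition divide_quat :: "quat \<Rightarrow> quat \<Rightarrow> quat" where
  "x div y = x * inverse (y :: quat)"

instance
proof
  fix x y :: quat and r :: real and U :: "quat set"
  have norm_eq: "norm q = sqrt (qnorm_sq q)" for q :: quat
    by (simp add: norm_quat_def qnorm_sq_def power2_eq_square)
  have norm_sq: "(norm q)\<^sup>2 = qnorm_sq q" for q :: quat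
    by (simp add: norm_eq qnorm_sq_nonneg)
  show norm_0: "norm x = 0 \<longleftrightarrow> x = 0"
    by (simp add: norm_eq qnorm_sq_eq_0_iff)
  have "norm q = norm (qRe q, qIm1 q, qIm2 q, qIm3 q)" for q :: quat
    by (simp add: norm_eq qnorm_sq_def norm_Pair add.assoc)
  then show "norm (x + y) \<le> norm x + norm y"
    using norm_triangle_ineq[of "(qRe x, qIm1 x, qIm2 x, qIm3 x)"
        "(qRe y, qIm1 y, qIm2 y, qIm3 y)"] by simp
  have "qnorm_sq (r *\<^sub>R x) = r\<^sup>2 * qnorm_sq x"
    by (simp add: qnorm_sq_def power_mult_distrib distrib_left)
  then show "norm (r *\<^sub>R x) = \<bar>r\<bar> * norm x"
    by (simp add: norm_eq real_sqrt_mult)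
  show "norm (x * y) = norm x * norm y"
    by (simp add: norm_eq qnorm_sq_mult real_sqrt_mult)
  show "x \<noteq> 0 \<Longrightarrow> inverse x * x = 1"
    by (simp add: inverse_quat_def norm_sq qcnj_mult_quat of_real_def qnorm_sq_eq_0_iff)
  show "x \<noteq> 0 \<Longrightarrow> x * inverse x = 1"
    by (simp add: inverse_quat_def norm_sq quat_mult_qcnj of_real_def qnorm_sq_eq_0_iff)
  show "inverse (0 :: quat) = 0"
    by (simp add: inverse_quat_def quat_eq_iff)
qed (simp_all only: sgn_quat_def dist_quat_def uniformity_quat_def open_quat_def divide_quat_def)

end


section \<open>The Dieudonne determinant\<close>

definition quat_GL :: "nat \<Rightarrow> quat mat monoid" where
  "quat_GL n = units_of (ring_mat TYPE(quat) n ())"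

definition pos_reals :: "real monoid" where
  "pos_reals = \<lparr>carrier = {0<..}, mult = (*), one = 1\<rparr>"

definition elementary_quat_mat :: "nat \<Rightarrow> quat mat \<Rightarrow> bool" where
  "elementary_quat_mat n E \<longleftrightarrow>
     E \<in> carrier_mat n n \<and> (\<forall>i<n. E $$ (i, i) = 1) \<and>
     card {(i, j). i < n \<and> j < n \<and> i \<noteq> j \<and> E $$ (i, j) \<noteq> 0} \<le> 1"

text \<open>HOL functions are total, so the values outside \<open>quat_GL n\<close> have to be pinned down
  (by \<open>extensional\<close>) for the homomorphism to be unique.\<close>

definition is_dieudonne_hom :: "nat \<Rightarrow> (quat mat \<Rightarrow> real) \<Rightarrow> bool" where
  "is_dieudonne_hom n f \<longleftrightarrow>
     f \<in> hom (quat_GL n) pos_reals \<and>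
     f \<in> extensional (carrier (quat_GL n)) \<and>
     (\<forall>E. elementary_quat_mat n E \<longrightarrow> f E = 1) \<and>
     (\<forall>X\<in>carrier (quat_GL n). diagonal_mat X \<longrightarrow> f X = (\<Prod>i<n. norm (X $$ (i, i))))"

definition dieudonne_hom :: "nat \<Rightarrow> quat mat \<Rightarrow> real" where
  "dieudonne_hom n = (THE f. is_dieudonne_hom n f)"

definition dieudonne_det :: "quat mat \<Rightarrow> real" where
  "dieudonne_det X =
     (if X \<in> carrier (quat_GL (dim_row X)) then dieudonne_hom (dim_row X) X else 0)"

end

theory Submission
  imports Defs
begin

text \<open>For an invertible matrix \<open>A\<close> with inverse \<open>B\<close> the Dieudonne determinant obeys Cramer's rule
  in absolute value, \<open>D(M\<^bsub>pq\<^esub>) = |B\<^bsub>qp\<^esub>| D(A)\<close>. Hence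
  \<open>\<Sum>\<^sub>i |A\<^bsub>pi\<^esub>| D(M\<^bsub>pi\<^esub>) = D(A) \<Sum>\<^sub>i |A\<^bsub>pi\<^esub>| |B\<^bsub>ip\<^esub>| \<ge> D(A) |\<Sum>\<^sub>i A\<^bsub>pi\<^esub> B\<^bsub>ip\<^esub>| = D(A)\<close>,
  and the expansion along a column is the same with \<open>B A = 1\<close> in place of \<open>A B = 1\<close>. For singular
  \<open>A\<close> the inequalities hold because \<open>D(A) = 0\<close>.

  Cramer's rule follows from multiplicativity: if \<open>R\<close> is \<open>A\<close> with row \<open>p\<close> replaced by the
  \<open>q\<close>-th unit vector, then \<open>D(R) = D(M\<^bsub>pq\<^esub>)\<close>, and \<open>R B\<close> is the identity matrix with row \<open>p\<close>
  replaced by row \<open>q\<close> of \<open>B\<close>, so that \<open>D(R B) = |B\<^bsub>qp\<^esub>|\<close>.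

  This presupposes a workable form of \<open>D\<close>, which is defined only by its characteristic
  properties. A quaternionic \<open>n \<times> n\<close> matrix is also a real \<open>4n \<times> 4n\<close> matrix, by letting
  each entry act on \<open>\<real>\<^sup>4\<close> from the left, and \<open>D\<close> is the fourth root of the absolute value of the
  real determinant (\<open>dieudonne_det_eq_real_det_root\<close>). This root is multiplicative and has the
  prescribed values on diagonal and elementary matrices, which gives existence. Uniqueness
  is Gaussian elimination over a skew field: every square matrix is a product of transvections and
  diagonal matrices (\<open>carrier_mat_eq_elimination_products\<close>). The same fact shows that a
  quaternionic matrix with nonzero real determinant has a quaternionic inverse, so the formula
  holds for singular matrices and minors too.\<close>

section \<open>Products of transvections and diagonal matrices\<close>

text \<open>The identity matrix with row \<open>p\<close> replaced by \<open>b\<close>. Such matrices serve twice: those with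
  \<open>b p = 1\<close> clear a whole row in elimination, and the general ones are what Cramer's rule produces.\<close>

definition one_with_row :: "nat \<Rightarrow> nat \<Rightarrow> (nat \<Rightarrow> 'a) \<Rightarrow> 'a :: semiring_1 mat" where
  "one_with_row n p b = mat n n (\<lambda>(i, j). if i = p then b j else if i = j then 1 else 0)"

definition transvection :: "nat \<Rightarrow> nat \<Rightarrow> nat \<Rightarrow> 'a \<Rightarrow> 'a :: semiring_1 mat" where
  "transvection n p q a = one_with_row n p ((\<lambda>_. 0)(p := 1, q := a))"

lemma one_with_row_carrier [simp]: "one_with_row n p b \<in> carrier_mat n n"
  and one_with_row_dim [simp]: "dim_row (one_with_row n p b) = n" "dim_col (one_with_row n p b) = n"
  by (simp_all add: one_with_row_def)

lemma one_with_row_index: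
  "i < n \<Longrightarrow> j < n \<Longrightarrow>
    one_with_row n p b $$ (i, j) = (if i = p then b j else if i = j then 1 else 0)"
  by (simp add: one_with_row_def)

lemma transvection_carrier [simp]: "transvection n p q a \<in> carrier_mat n n"
  by (simp add: transvection_def)

lemma mult_mat_index:
  assumes "A \<in> carrier_mat m k" "B \<in> carrier_mat k n" "i < m" "j < n"
  shows "(A * B) $$ (i, j) = (\<Sum>l<k. A $$ (i, l) * B $$ (l, j))"
  using assms by (auto simp: scalar_prod_def lessThan_atLeast0 intro!: sum.cong)

lemma one_with_row_mult_index:
  fixes X :: "'a :: semiring_1 mat"
  assumes "X \<in> carrier_mat n n" "i < n" "j < n"
  shows "(one_with_row n p b * X) $$ (i, j) =
    (if i = p then \<Sum>k<n. b k * X $$ (k, j) else X $$ (i, j))"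
proof -
  have "(one_with_row n p b * X) $$ (i, j) =
      (\<Sum>k<n. one_with_row n p b $$ (i, k) * X $$ (k, j))"
    using assms by (intro mult_mat_index) auto
  also have "\<dots> = (\<Sum>k<n. if i = p then b k * X $$ (k, j) else if i = k then X $$ (k, j) else 0)"
    using assms by (intro sum.cong) (auto simp: one_with_row_index)
  also have "\<dots> = (if i = p then \<Sum>k<n. b k * X $$ (k, j) else X $$ (i, j))"
    using assms by auto
  finally show ?thesis .
qed

lemma mult_one_with_row_index:
  fixes X :: "'a :: semiring_1 mat"
  assumes "X \<in> carrier_mat n n" "p < n" "i < n" "j < n"
  shows "(X * one_with_row n p b) $$ (i, j) =
    X $$ (i, p) * b j + (if j = p then 0 else X $$ (i, j))"
proof -
  have "(X * one_with_row n p b) $$ (i, j) =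
      (\<Sum>k<n. X $$ (i, k) * one_with_row n p b $$ (k, j))"
    using assms by (intro mult_mat_index) auto
  also have "\<dots> = (\<Sum>k<n. (if k = p then X $$ (i, p) * b j else 0) +
      (if k = j then if j = p then 0 else X $$ (i, j) else 0))"
    using assms by (intro sum.cong) (auto simp: one_with_row_index)
  also have "\<dots> = X $$ (i, p) * b j + (if j = p then 0 else X $$ (i, j))"
    using assms by (simp add: sum.distrib)
  finally show ?thesis .
qed

lemma one_with_row_mult_one_with_row:
  fixes b c :: "nat \<Rightarrow> 'a :: semiring_1"
  assumes "p < n"
  shows "one_with_row n p b * one_with_row n p c =
    one_with_row n p (\<lambda>j. b p * c j + (if j = p then 0 else b j))"
  by (rule eq_matI) (use assms in \<open>auto simp del: index_mult_mat(1)
    simp: mult_one_with_row_index one_with_row_index\<close>)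

lemma one_with_unit_row: "one_with_row n p ((\<lambda>_. 0)(p := 1)) = 1\<^sub>m n"
  by (rule eq_matI) (auto simp: one_with_row_index)

lemma one_with_row_inverse:
  fixes b :: "nat \<Rightarrow> 'a :: ring_1"
  assumes "p < n" "b p = 1"
  shows "one_with_row n p b * one_with_row n p ((\<lambda>j. - b j)(p := 1)) = 1\<^sub>m n"
    and "one_with_row n p ((\<lambda>j. - b j)(p := 1)) * one_with_row n p b = 1\<^sub>m n"
proof -
  have *: "one_with_row n p c = 1\<^sub>m n" if "c = (\<lambda>_. 0)(p := 1)" for c :: "nat \<Rightarrow> 'a"
    using that one_with_unit_row by simp
  show "one_with_row n p b * one_with_row n p ((\<lambda>j. - b j)(p := 1)) = 1\<^sub>m n"
    unfolding one_with_row_mult_one_with_row[OF assms(1)] by (rule *) (auto simp: assms)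
  show "one_with_row n p ((\<lambda>j. - b j)(p := 1)) * one_with_row n p b = 1\<^sub>m n"
    unfolding one_with_row_mult_one_with_row[OF assms(1)] by (rule *) (auto simp: assms)
qed

inductive_set elimination_products :: "nat \<Rightarrow> 'a :: semiring_1 mat set" for n where
  transvection:
    "p < n \<Longrightarrow> q < n \<Longrightarrow> p \<noteq> q \<Longrightarrow> transvection n p q a \<in> elimination_products n"
| diagonal: "X \<in> carrier_mat n n \<Longrightarrow> diagonal_mat X \<Longrightarrow> X \<in> elimination_products n"
| mult: "X \<in> elimination_products n \<Longrightarrow> Y \<in> elimination_products n \<Longrightarrow>
    X * Y \<in> elimination_products n"

lemma elimination_products_carrier: "X \<in> elimination_products n \<Longrightarrow> X \<in> carrier_mat n n"
  by (induction rule: elimination_products.induct) auto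

lemma one_with_row_in_elimination_products:
  fixes b :: "nat \<Rightarrow> 'a :: semiring_1"
  assumes p: "p < n" and b: "b p = 1"
  shows "one_with_row n p b \<in> elimination_products n"
proof -
  have *: "one_with_row n p (\<lambda>j. if j = p then 1 else if j \<in> J then b j else 0)
      \<in> elimination_products n" (is "?E J \<in> _")
    if "finite J" "J \<subseteq> {..<n} - {p}" for J
    using that
  proof (induction J)
    case empty
    have "?E {} = 1\<^sub>m n"
      by (rule eq_matI) (auto simp: one_with_row_index)
    then show ?case
      by (auto intro!: elimination_products.diagonal simp: diagonal_mat_def)
  next
    case (insert q J)
    have "transvection n p q (b q) * ?E J = ?E (insert q J)"
      unfolding transvection_def one_with_row_mult_one_with_row[OF p]
      by (rule eq_matI) (use insert.hyps insert.prems in \<open>auto simp: one_with_row_index\<close>)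
    moreover have "transvection n p q (b q) * ?E J \<in> elimination_products n"
      using insert p by (intro elimination_products.mult elimination_products.transvection) auto
    ultimately show ?case by simp
  qed
  have "?E ({..<n} - {p}) = one_with_row n p b"
    by (rule eq_matI) (auto simp: one_with_row_index b)
  with *[of "{..<n} - {p}"] show ?thesis by simp
qed

lemma elimination_products_cancel_right:
  fixes X :: "'a :: ring_1 mat"
  assumes X: "X \<in> carrier_mat n n" and p: "p < n" and b: "b p = 1"
    and XE: "X * one_with_row n p b \<in> elimination_products n"
  shows "X \<in> elimination_products n"
proof -
  let ?E = "one_with_row n p b" and ?F = "one_with_row n p ((\<lambda>j. - b j)(p := 1))"
  have "?F \<in> elimination_products n"
    using p by (intro one_with_row_in_elimination_products) auto
  with XE have "X * ?E * ?F \<in> elimination_products n"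
    by (rule elimination_products.mult)
  also have "X * ?E * ?F = X * (?E * ?F)"
    using X by (intro assoc_mult_mat) auto
  also have "\<dots> = X"
    using X p b by (simp add: one_with_row_inverse)
  finally show ?thesis .
qed

lemma elimination_products_cancel_left:
  fixes X :: "'a :: ring_1 mat"
  assumes X: "X \<in> carrier_mat n n" and p: "p < n" and b: "b p = 1"
    and EX: "one_with_row n p b * X \<in> elimination_products n"
  shows "X \<in> elimination_products n"
proof -
  let ?E = "one_with_row n p b" and ?F = "one_with_row n p ((\<lambda>j. - b j)(p := 1))"
  have "?F \<in> elimination_products n"
    using p by (intro one_with_row_in_elimination_products) auto
  then have "?F * (?E * X) \<in> elimination_products n"
    using EX by (rule elimination_products.mult)
  also have "?F * (?E * X) = ?F * ?E * X"
    using X by (intro assoc_mult_mat[symmetric]) auto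
  also have "\<dots> = X"
    using X p b by (simp add: one_with_row_inverse)
  finally show ?thesis .
qed

text \<open>Elimination one row at a time: after step \<open>k\<close> the first \<open>k\<close> rows have no off-diagonal
  entries. If the pivot \<open>X\<^bsub>kk\<^esub>\<close> is nonzero, adding multiples of column \<open>k\<close> clears row \<open>k\<close> and
  leaves the earlier rows alone, as column \<open>k\<close> vanishes there. If the pivot is zero but some
  column \<open>j \<noteq> k\<close> with \<open>X\<^bsub>kj\<^esub> \<noteq> 0\<close> vanishes in all earlier rows, adding it to column \<open>k\<close> yields a
  nonzero pivot. In the remaining case each nonzero entry \<open>X\<^bsub>kj\<^esub>\<close> has \<open>j < k\<close> and lies below
  a nonzero diagonal entry, so multiples of the earlier rows clear row \<open>k\<close>. Singular matrices are
  covered as well.\<close>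

theorem carrier_mat_eq_elimination_products:
  "elimination_products n = (carrier_mat n n :: 'a :: division_ring mat set)"
proof -
  have "X \<in> elimination_products n"
    if "k \<le> n" "X \<in> carrier_mat n n" "\<forall>i<k. \<forall>j<n. j \<noteq> i \<longrightarrow> X $$ (i, j) = 0"
    for k and X :: "'a mat"
    using that
  proof (induction k arbitrary: X rule: inc_induct)
    case base
    then show ?case
      by (intro elimination_products.diagonal) (auto simp: diagonal_mat_def)
  next
    case (step k)
    note k = \<open>k < n\<close>
    have pivot: "X \<in> elimination_products n"
      if X: "X \<in> carrier_mat n n" and clean: "\<forall>i<k. \<forall>j<n. j \<noteq> i \<longrightarrow> X $$ (i, j) = 0"
        and nz: "X $$ (k, k) \<noteq> 0" for X :: "'a mat"
    proof -
      define b where "b = (\<lambda>j. - (inverse (X $$ (k, k)) * X $$ (k, j)))(k := 1)"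
      have [simp]: "X $$ (k, k) * (inverse (X $$ (k, k)) * z) = z" for z
        using nz by (simp flip: mult.assoc)
      show ?thesis
      proof (rule elimination_products_cancel_right[OF X k])
        show "b k = 1" by (simp add: b_def)
        show "X * one_with_row n k b \<in> elimination_products n"
          by (rule step.IH) (use X k clean in
            \<open>auto simp del: index_mult_mat(1) simp: mult_one_with_row_index b_def less_Suc_eq\<close>)
      qed
    qed
    show ?case
    proof (cases "X $$ (k, k) = 0 \<and> (\<exists>j<n. j \<noteq> k \<and> X $$ (k, j) \<noteq> 0 \<and> (\<forall>i<k. X $$ (i, j) = 0))")
      case True
      then obtain j where j: "j < n" "j \<noteq> k" "X $$ (k, j) \<noteq> 0" "\<forall>i<k. X $$ (i, j) = 0"
        and kk: "X $$ (k, k) = 0" by blast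
      \<comment> \<open>Right multiplication by this transvection adds column \<open>j\<close> to column \<open>k\<close>.\<close>
      define b :: "nat \<Rightarrow> 'a" where "b = (\<lambda>_. 0)(j := 1, k := 1)"
      have "X * one_with_row n j b \<in> elimination_products n"
        by (rule pivot) (use step.prems k j kk in
          \<open>auto simp del: index_mult_mat(1) simp: mult_one_with_row_index b_def\<close>)
      then show ?thesis
        using j by (intro elimination_products_cancel_right[of X n j b] step.prems) (auto simp: b_def)
    next
      case no_col: False
      show ?thesis
      proof (cases "X $$ (k, k) = 0")
        case False
        then show ?thesis
          using step.prems by (intro pivot) auto
      next
        case True
        have diag: "j < k \<and> X $$ (j, j) \<noteq> 0" if "j < n" "j \<noteq> k" "X $$ (k, j) \<noteq> 0" for j
        proof -
          obtain i where "i < k" "X $$ (i, j) \<noteq> 0"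
            using no_col True \<open>j < n\<close> \<open>j \<noteq> k\<close> \<open>X $$ (k, j) \<noteq> 0\<close> by blast
          moreover from this have "i = j"
            using step.prems \<open>j < n\<close> by blast
          ultimately show ?thesis by simp
        qed
        define b where "b = (\<lambda>j. if X $$ (k, j) = 0 then 0 else
          - (X $$ (k, j) * inverse (X $$ (j, j))))(k := 1)"
        have "one_with_row n k b * X \<in> elimination_products n"
        proof (rule step.IH)
          have "(\<Sum>l<n. b l * X $$ (l, j)) = 0" if j: "j < n" "j \<noteq> k" for j
          proof -
            have "(\<Sum>l<n. b l * X $$ (l, j)) =
                (\<Sum>l<n. (if l = k then X $$ (k, j) else 0) + (if l = j then - X $$ (k, j) else 0))"
            proof (rule sum.cong)
              fix l assume "l \<in> {..<n}"
              then have l: "l < n" by simp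
              have "b l * X $$ (l, j) = 0" if "l \<noteq> j" "l \<noteq> k"
                using diag[OF l that(2)] step.prems that j by (auto simp: b_def)
              moreover have "b j * X $$ (j, j) = - X $$ (k, j)"
                using diag[OF j] j by (auto simp: b_def mult.assoc)
              ultimately show "b l * X $$ (l, j) =
                (if l = k then X $$ (k, j) else 0) + (if l = j then - X $$ (k, j) else 0)"
                using j by (auto simp: b_def)
            qed simp
            also have "\<dots> = 0"
              using j k by (simp add: sum.distrib)
            finally show ?thesis .
          qed
          then show "\<forall>i<Suc k. \<forall>j<n. j \<noteq> i \<longrightarrow> (one_with_row n k b * X) $$ (i, j) = 0"
            using step.prems k
            by (auto simp del: index_mult_mat(1) simp: one_with_row_mult_index less_Suc_eq)
        qed (use step.prems in auto)
        then show ?thesis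
          using k by (intro elimination_products_cancel_left[of X n k b] step.prems) (auto simp: b_def)
      qed
    qed
  qed
  from this[of 0] show ?thesis
    by (auto intro: elimination_products_carrier)
qed

section \<open>The real matrix of a quaternionic matrix\<close>

definition quat_component :: "nat \<Rightarrow> quat \<Rightarrow> real" where
  "quat_component k q =
    (if k = 0 then qRe q else if k = 1 then qIm1 q else if k = 2 then qIm2 q else qIm3 q)"

definition quat_unit :: "nat \<Rightarrow> quat" where
  "quat_unit l = Quat (of_bool (l = 0)) (of_bool (l = 1)) (of_bool (l = 2)) (of_bool (l = 3))"

text \<open>The matrix of \<open>x \<mapsto> q x\<close> in the real basis \<open>1, i, j, k\<close>; multiplication on the left
  makes \<open>q \<mapsto> left_mult_entry q\<close> a homomorphism, with conjugation going to transposition.\<close>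

definition left_mult_entry :: "quat \<Rightarrow> nat \<Rightarrow> nat \<Rightarrow> real" where
  "left_mult_entry q k l = quat_component k (q * quat_unit l)"

definition real_mat :: "quat mat \<Rightarrow> real mat" where
  "real_mat X = mat (dim_row X * 4) (dim_col X * 4)
    (\<lambda>(r, s). left_mult_entry (X $$ (r div 4, s div 4)) (r mod 4) (s mod 4))"

lemma less_4_cases: "k < 4 \<longleftrightarrow> k = 0 \<or> k = 1 \<or> k = 2 \<or> k = (3 :: nat)"
  by auto

lemma sum_lessThan_4: "(\<Sum>l<4. f l) = f 0 + f 1 + f 2 + f (3 :: nat)"
  for f :: "nat \<Rightarrow> 'a :: comm_monoid_add"
  by (simp add: eval_nat_numeral add.assoc)

text \<open>The first factor acts linearly on the coordinates of \<open>y e\<^sub>m\<close>, so this is associativity of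
  quaternion multiplication.\<close>

lemma left_mult_entry_mult:
  "(\<Sum>l<4. left_mult_entry x k l * left_mult_entry y l m) = left_mult_entry (x * y) k m"
proof -
  have *: "(\<Sum>l<4. left_mult_entry x k l * quat_component l z) = quat_component k (x * z)" for z
    by (simp add: sum_lessThan_4 left_mult_entry_def quat_component_def quat_unit_def algebra_simps)
  show ?thesis
    using *[of "y * quat_unit m"] by (simp add: left_mult_entry_def mult.assoc)
qed

lemma quat_component_sum: "quat_component k (\<Sum>i\<in>I. f i) = (\<Sum>i\<in>I. quat_component k (f i))"
proof -
  have "quat_component k (x + y) = quat_component k x + quat_component k y"
    "quat_component k 0 = 0" for x y
    by (auto simp: quat_component_def)
  then show ?thesis
    by (induction I rule: infinite_finite_induct) auto
qed

lemma left_mult_entry_sum: "left_mult_entry (\<Sum>i\<in>I. f i) k l = (\<Sum>i\<in>I. left_mult_entry (f i) k l)"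
  by (simp add: left_mult_entry_def sum_distrib_right quat_component_sum)

lemma left_mult_entry_0 [simp]: "left_mult_entry 0 k l = 0"
  by (simp add: left_mult_entry_def quat_component_def)

lemma left_mult_entry_of_real:
  assumes "k < 4" "l < 4"
  shows "left_mult_entry (of_real r) k l = (if k = l then r else 0)"
  using assms by (auto simp: left_mult_entry_def quat_component_def quat_unit_def less_4_cases of_real_def)

lemma left_mult_entry_1:
  "k < 4 \<Longrightarrow> l < 4 \<Longrightarrow> left_mult_entry 1 k l = (if k = l then 1 else 0)"
  using left_mult_entry_of_real[of k l 1] by simp

lemma left_mult_entry_qcnj:
  "k < 4 \<Longrightarrow> l < 4 \<Longrightarrow> left_mult_entry (qcnj q) k l = left_mult_entry q l k"
  by (auto simp: left_mult_entry_def quat_component_def quat_unit_def less_4_cases)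

lemma real_mat_carrier [simp]: "X \<in> carrier_mat m n \<Longrightarrow> real_mat X \<in> carrier_mat (m * 4) (n * 4)"
  by (auto simp: real_mat_def)

lemma real_mat_dim [simp]:
  "dim_row (real_mat X) = dim_row X * 4" "dim_col (real_mat X) = dim_col X * 4"
  by (simp_all add: real_mat_def)

lemma real_mat_index:
  "X \<in> carrier_mat m n \<Longrightarrow> r < m * 4 \<Longrightarrow> s < n * 4 \<Longrightarrow>
    real_mat X $$ (r, s) = left_mult_entry (X $$ (r div 4, s div 4)) (r mod 4) (s mod 4)"
  by (auto simp: real_mat_def)

lemma sum_lessThan_mult_4: "(\<Sum>r<n * 4. f r) = (\<Sum>i<n. \<Sum>k<4. f (i * 4 + k))"
  for f :: "nat \<Rightarrow> 'a :: comm_monoid_add"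
proof (induction n)
  case (Suc n)
  have "sum f {..<m + 4} = sum f {..<m} + (\<Sum>k<4. f (m + k))" for m
    by (simp add: eval_nat_numeral add.assoc)
  from this[of "n * 4"] Suc show ?case
    by (simp add: add.commute)
qed simp

lemma prod_lessThan_mult_4: "(\<Prod>r<n * 4. f r) = (\<Prod>i<n. \<Prod>k<4. f (i * 4 + k))"
  for f :: "nat \<Rightarrow> 'a :: comm_monoid_mult"
proof (induction n)
  case (Suc n)
  have "prod f {..<m + 4} = prod f {..<m} * (\<Prod>k<4. f (m + k))" for m
    by (simp add: eval_nat_numeral mult.assoc)
  from this[of "n * 4"] Suc show ?case
    by (simp add: add.commute)
qed simp

lemma real_mat_mult:
  assumes X: "X \<in> carrier_mat m k" and Y: "Y \<in> carrier_mat k n"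
  shows "real_mat (X * Y) = real_mat X * real_mat Y"
proof (rule eq_matI)
  fix r s assume "r < dim_row (real_mat X * real_mat Y)" "s < dim_col (real_mat X * real_mat Y)"
  then have r: "r < m * 4" and s: "s < n * 4"
    using X Y by auto
  define i j where "i = r div 4" and "j = s div 4"
  have ij: "i < m" "j < n"
    using r s by (auto simp: i_def j_def)
  have "(real_mat X * real_mat Y) $$ (r, s) = (\<Sum>t<k * 4. real_mat X $$ (r, t) * real_mat Y $$ (t, s))"
    using X Y r s by (intro mult_mat_index) auto
  also have "\<dots> = (\<Sum>t<k * 4. left_mult_entry (X $$ (i, t div 4)) (r mod 4) (t mod 4) *
      left_mult_entry (Y $$ (t div 4, j)) (t mod 4) (s mod 4))"
    using r s by (intro sum.cong) (auto simp: real_mat_index[OF X] real_mat_index[OF Y] i_def j_def)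
  also have "\<dots> = (\<Sum>h<k. \<Sum>l<4. left_mult_entry (X $$ (i, h)) (r mod 4) l *
      left_mult_entry (Y $$ (h, j)) l (s mod 4))"
    unfolding sum_lessThan_mult_4 by (intro sum.cong) auto
  also have "\<dots> = left_mult_entry (\<Sum>h<k. X $$ (i, h) * Y $$ (h, j)) (r mod 4) (s mod 4)"
    by (simp add: left_mult_entry_mult left_mult_entry_sum)
  also have "(\<Sum>h<k. X $$ (i, h) * Y $$ (h, j)) = (X * Y) $$ (i, j)"
    using X Y ij by (intro mult_mat_index[symmetric]) auto
  also have "left_mult_entry ((X * Y) $$ (i, j)) (r mod 4) (s mod 4) = real_mat (X * Y) $$ (r, s)"
    unfolding i_def j_def
    by (rule real_mat_index[OF mult_carrier_mat[OF X Y] r s, symmetric])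
  finally show "real_mat (X * Y) $$ (r, s) = (real_mat X * real_mat Y) $$ (r, s)" by simp
qed (use X Y in auto)

text \<open>A quaternion \<open>q\<close> acts on \<open>\<real>\<^sup>4\<close> with determinant \<open>|q|\<^sup>4\<close>, hence the fourth root.\<close>

definition real_det_root :: "quat mat \<Rightarrow> real" where
  "real_det_root X = root 4 \<bar>det (real_mat X)\<bar>"

lemma real_det_root_nonneg: "0 \<le> real_det_root X"
  by (simp add: real_det_root_def)

lemma real_det_root_mult:
  assumes "X \<in> carrier_mat n n" "Y \<in> carrier_mat n n"
  shows "real_det_root (X * Y) = real_det_root X * real_det_root Y"
proof -
  have "det (real_mat (X * Y)) = det (real_mat X) * det (real_mat Y)"
    unfolding real_mat_mult[OF assms]
    by (rule det_mult[of _ "n * 4"]) (use assms in auto)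
  then show ?thesis
    by (simp add: real_det_root_def abs_mult real_root_mult)
qed

lemma real_det_root_real_diagonal:
  assumes X: "X \<in> carrier_mat n n" and d: "diagonal_mat X"
    and real: "\<And>i. i < n \<Longrightarrow> X $$ (i, i) = of_real (c i)"
  shows "real_det_root X = (\<Prod>i<n. \<bar>c i\<bar>)"
proof -
  have entry: "real_mat X $$ (r, s) = (if r = s then c (r div 4) else 0)"
    if r: "r < n * 4" and s: "s < n * 4" for r s
  proof (cases "r div 4 = s div 4")
    case True
    have "r div 4 < n" using r by auto
    moreover have "r mod 4 = s mod 4 \<longleftrightarrow> r = s"
      using True by (metis div_mod_decomp)
    ultimately show ?thesis
      using True by (auto simp: real_mat_index[OF X r s] real left_mult_entry_of_real)
  next
    case False
    moreover have "r div 4 < n" "s div 4 < n" using r s by auto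
    ultimately have "X $$ (r div 4, s div 4) = 0"
      using d X by (auto simp: diagonal_mat_def)
    with False show ?thesis
      by (auto simp: real_mat_index[OF X r s])
  qed
  have "det (real_mat X) = prod_list (diag_mat (real_mat X))"
    using X by (intro det_upper_triangular[of _ "n * 4"]) (auto simp: upper_triangular_def entry)
  also have "\<dots> = (\<Prod>r<n * 4. c (r div 4))"
    using X by (auto simp: prod_list_diag_prod entry lessThan_atLeast0 intro!: prod.cong)
  also have "\<dots> = (\<Prod>i<n. c i) ^ 4"
  proof -
    have "(\<Prod>k<4. c ((i * 4 + k) div 4)) = c i ^ 4" for i
    proof -
      have "(\<Prod>k<4. c ((i * 4 + k) div 4)) = (\<Prod>k<(4 :: nat). c i)"
        by (intro prod.cong) auto
      then show ?thesis by simp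
    qed
    then show ?thesis
      unfolding prod_lessThan_mult_4 by (simp add: prod_power_distrib)
  qed
  finally have "\<bar>det (real_mat X)\<bar> = (\<Prod>i<n. \<bar>c i\<bar>) ^ 4"
    by (simp add: power_abs abs_prod)
  then show ?thesis
    by (simp add: real_det_root_def real_root_power_cancel prod_nonneg)
qed

lemma norm_quat_eq: "(norm q)\<^sup>2 = qnorm_sq q" for q :: quat
proof -
  have "norm q = sqrt (qnorm_sq q)"
    by (simp add: norm_quat_def qnorm_sq_def power2_eq_square)
  then show ?thesis by (simp add: qnorm_sq_nonneg)
qed

text \<open>With \<open>X\<^sup>*\<close> the conjugate transpose, \<open>X X\<^sup>*\<close> is the real diagonal matrix of the
  \<open>|X\<^bsub>ii\<^esub>|\<^sup>2\<close>, whose real matrix is diagonal too; and \<open>X\<^sup>*\<close> has the same determinant as \<open>X\<close>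
  since its real matrix is the transpose. So the square of the determinant is known.\<close>

lemma real_det_root_diagonal:
  assumes X: "X \<in> carrier_mat n n" and d: "diagonal_mat X"
  shows "real_det_root X = (\<Prod>i<n. norm (X $$ (i, i)))"
proof -
  define Y where "Y = mat n n (\<lambda>(i, j). qcnj (X $$ (j, i)))"
  have Y: "Y \<in> carrier_mat n n" by (simp add: Y_def)
  have Y_index: "Y $$ (i, j) = qcnj (X $$ (j, i))" if "i < n" "j < n" for i j
    using that by (simp add: Y_def)
  have "real_mat Y = transpose_mat (real_mat X)"
  proof (rule eq_matI)
    fix r s assume "r < dim_row (transpose_mat (real_mat X))" "s < dim_col (transpose_mat (real_mat X))"
    then have rs: "r < n * 4" "s < n * 4" using X by auto
    then have "r div 4 < n" "s div 4 < n" by auto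
    with rs show "real_mat Y $$ (r, s) = transpose_mat (real_mat X) $$ (r, s)"
      using X by (simp add: real_mat_index[OF Y] real_mat_index[OF X] Y_index left_mult_entry_qcnj)
  qed (use X Y in auto)
  then have "real_det_root Y = real_det_root X"
    using det_transpose[of "real_mat X" "n * 4"] X by (simp add: real_det_root_def)
  then have "(real_det_root X)\<^sup>2 = real_det_root (X * Y)"
    using real_det_root_mult[OF X Y] by (simp add: power2_eq_square)
  also have "\<dots> = (\<Prod>i<n. \<bar>(norm (X $$ (i, i)))\<^sup>2\<bar>)"
  proof (rule real_det_root_real_diagonal)
    have XY: "(X * Y) $$ (i, j) = (if i = j then X $$ (i, i) * qcnj (X $$ (i, i)) else 0)"
      if "i < n" "j < n" for i j
    proof -
      have "(X * Y) $$ (i, j) = (\<Sum>k<n. X $$ (i, k) * Y $$ (k, j))"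
        using X Y that by (intro mult_mat_index) auto
      also have "\<dots> = (\<Sum>k<n. if k = i then X $$ (i, i) * Y $$ (i, j) else 0)"
        using X d that by (intro sum.cong) (auto simp: diagonal_mat_def)
      also have "\<dots> = X $$ (i, i) * Y $$ (i, j)"
        using that by simp
      also have "\<dots> = (if i = j then X $$ (i, i) * qcnj (X $$ (i, i)) else 0)"
        using X d that by (auto simp: diagonal_mat_def Y_index qcnj_def quat_eq_iff)
      finally show ?thesis .
    qed
    show "diagonal_mat (X * Y)"
      using X Y XY by (auto simp del: index_mult_mat(1) simp: diagonal_mat_def)
    show "(X * Y) $$ (i, i) = of_real ((norm (X $$ (i, i)))\<^sup>2)" if "i < n" for i
      using XY[of i i] that by (simp only: quat_mult_qcnj norm_quat_eq refl if_True)
  qed (use X Y in auto)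
  also have "\<dots> = (\<Prod>i<n. norm (X $$ (i, i)))\<^sup>2"
    by (simp add: prod_power_distrib)
  finally show ?thesis
    by (simp add: real_det_root_nonneg prod_nonneg)
qed

lemma real_det_root_one: "real_det_root (1\<^sub>m n) = 1"
  using real_det_root_diagonal[of "1\<^sub>m n" n] by (simp add: diagonal_mat_def)

text \<open>Conjugating \<open>U\<close> by the diagonal matrix \<open>T\<close> with \<open>2\<close> at \<open>p\<close> doubles the off-diagonal
  entries of row \<open>p\<close>, and so does squaring \<open>U\<close>. From \<open>T U = U\<^sup>2 T\<close> and multiplicativity the
  determinant of the invertible matrix \<open>U\<close> is its own square. Transvections are a special case.\<close>

lemma real_det_root_one_with_row_unit:
  assumes p: "p < n" and b: "b p = 1"
  shows "real_det_root (one_with_row n p b) = 1"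
proof -
  let ?U = "one_with_row n p b" and ?T = "one_with_row n p ((\<lambda>_. 0 :: quat)(p := 2))"
  have "diagonal_mat ?T"
    by (auto simp: diagonal_mat_def one_with_row_index)
  then have T: "real_det_root ?T = (\<Prod>i<n. norm (?T $$ (i, i)))"
    by (intro real_det_root_diagonal) auto
  also have "\<dots> > 0"
    by (intro prod_pos) (auto simp: one_with_row_index)
  finally have T_pos: "real_det_root ?T > 0" .
  have "?T * ?U = ?U * ?U * ?T"
    unfolding one_with_row_mult_one_with_row[OF p]
    by (rule eq_matI) (auto simp: one_with_row_index b mult_2 mult_2_right)
  then have "real_det_root ?T * real_det_root ?U = real_det_root ?U * real_det_root ?U * real_det_root ?T"
    by (metis real_det_root_mult one_with_row_carrier mult_carrier_mat)
  then have "real_det_root ?U = real_det_root ?U * real_det_root ?U"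
    using T_pos by simp
  moreover have "real_det_root ?U \<noteq> 0"
  proof
    assume "real_det_root ?U = 0"
    moreover have "real_det_root (?U * one_with_row n p ((\<lambda>j. - b j)(p := 1))) = 1"
      using one_with_row_inverse(1)[of p n b] p b by (simp add: real_det_root_one)
    ultimately show False
      by (simp add: real_det_root_mult[of _ n])
  qed
  ultimately show ?thesis by simp
qed

text \<open>The matrix is the one with \<open>b p\<close> changed to \<open>1\<close>, times the diagonal matrix with \<open>b p\<close> at \<open>p\<close>; the
  factorisation does not divide by \<open>b p\<close>, which may be zero.\<close>

lemma real_det_root_one_with_row:
  assumes p: "p < n"
  shows "real_det_root (one_with_row n p b) = norm (b p)"
proof -
  let ?U = "one_with_row n p (b(p := 1))" and ?T = "one_with_row n p ((\<lambda>_. 0)(p := b p))"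
  have "diagonal_mat ?T"
    by (auto simp: diagonal_mat_def one_with_row_index)
  then have "real_det_root ?T = (\<Prod>i<n. norm (?T $$ (i, i)))"
    by (intro real_det_root_diagonal) auto
  also have "\<dots> = (\<Prod>i<n. if i = p then norm (b p) else 1)"
    by (intro prod.cong) (auto simp: one_with_row_index)
  also have "\<dots> = norm (b p)"
    using p by simp
  finally have T: "real_det_root ?T = norm (b p)" .
  have "?U * ?T = one_with_row n p b"
    unfolding one_with_row_mult_one_with_row[OF p]
    by (rule eq_matI) (auto simp: one_with_row_index)
  moreover have "real_det_root (?U * ?T) = norm (b p)"
    using p by (simp add: real_det_root_mult[of _ n] real_det_root_one_with_row_unit T)
  ultimately show ?thesis by simp
qed

section \<open>The Dieudonne determinant as a root of a real determinant\<close>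

lemma carrier_quat_GL:
  "X \<in> carrier (quat_GL n) \<longleftrightarrow>
    X \<in> carrier_mat n n \<and> (\<exists>Y\<in>carrier_mat n n. Y * X = 1\<^sub>m n \<and> X * Y = 1\<^sub>m n)"
  by (auto simp: quat_GL_def units_of_def Units_def ring_mat_simps)

lemma quat_GL_mult:
  "X \<otimes>\<^bsub>quat_GL n\<^esub> Y = X * Y"
  by (simp add: quat_GL_def units_of_def ring_mat_simps)

lemma pos_reals_simps:
  "x \<otimes>\<^bsub>pos_reals\<^esub> y = x * y" "carrier pos_reals = {0<..}"
  by (simp_all add: pos_reals_def)

lemma mult_in_quat_GL:
  assumes "X \<in> carrier (quat_GL n)" "Y \<in> carrier (quat_GL n)"
  shows "X * Y \<in> carrier (quat_GL n)"
proof -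
  interpret semiring "ring_mat TYPE(quat) n ()" by (rule semiring_mat)
  show ?thesis
    using Units_m_closed[of X Y] assms by (simp add: quat_GL_def units_of_def ring_mat_simps)
qed

lemma real_det_root_quat_GL:
  assumes "X \<in> carrier (quat_GL n)"
  shows "real_det_root X > 0"
proof -
  obtain Y where Y: "Y \<in> carrier_mat n n" "X * Y = 1\<^sub>m n"
    and X: "X \<in> carrier_mat n n"
    using assms by (auto simp: carrier_quat_GL)
  have "real_det_root X * real_det_root Y = 1"
    using real_det_root_mult[OF X Y(1)] Y(2) by (simp add: real_det_root_one)
  then have "real_det_root X \<noteq> 0" by auto
  then show ?thesis using real_det_root_nonneg[of X] by simp
qed

lemma one_with_row_unit_in_quat_GL:
  assumes "p < n" "b p = 1"
  shows "one_with_row n p b \<in> carrier (quat_GL n)"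
  using one_with_row_inverse[of p n b] assms by (force simp: carrier_quat_GL)

lemma diagonal_in_quat_GL:
  assumes X: "X \<in> carrier_mat n n" and d: "diagonal_mat X"
    and nz: "\<And>i. i < n \<Longrightarrow> X $$ (i, i) \<noteq> 0"
  shows "X \<in> carrier (quat_GL n)"
proof -
  define Y where "Y = mat n n (\<lambda>(i, j). if i = j then inverse (X $$ (i, i)) else 0)"
  have Y: "Y \<in> carrier_mat n n" by (simp add: Y_def)
  have "(Y * X) $$ (i, j) = (1\<^sub>m n :: quat mat) $$ (i, j)" if ij: "i < n" "j < n" for i j
  proof -
    have "(Y * X) $$ (i, j) = (\<Sum>k<n. Y $$ (i, k) * X $$ (k, j))"
      using X Y ij by (intro mult_mat_index) auto
    also have "\<dots> = (\<Sum>k<n. if k = i then of_bool (i = j) else 0)"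
      using X d ij nz by (intro sum.cong) (auto simp: Y_def diagonal_mat_def)
    finally show ?thesis using ij by simp
  qed
  then have YX: "Y * X = 1\<^sub>m n"
    using X Y by (intro eq_matI) auto
  have "(X * Y) $$ (i, j) = (1\<^sub>m n :: quat mat) $$ (i, j)" if ij: "i < n" "j < n" for i j
  proof -
    have "(X * Y) $$ (i, j) = (\<Sum>k<n. X $$ (i, k) * Y $$ (k, j))"
      using X Y ij by (intro mult_mat_index) auto
    also have "\<dots> = (\<Sum>k<n. if k = i then of_bool (i = j) else 0)"
      using X d ij nz by (intro sum.cong) (auto simp: Y_def diagonal_mat_def)
    finally show ?thesis using ij by simp
  qed
  then have XY: "X * Y = 1\<^sub>m n"
    using X Y by (intro eq_matI) auto
  from X Y XY YX show ?thesis by (auto simp: carrier_quat_GL)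
qed

lemma elementary_transvection:
  assumes "p < n" "q < n" "p \<noteq> q"
  shows "elementary_quat_mat n (transvection n p q a)"
proof -
  have "{(i, j). i < n \<and> j < n \<and> i \<noteq> j \<and> transvection n p q a $$ (i, j) \<noteq> 0} \<subseteq> {(p, q)}"
    by (auto simp: transvection_def one_with_row_index split: if_splits)
  then have "card {(i, j). i < n \<and> j < n \<and> i \<noteq> j \<and> transvection n p q a $$ (i, j) \<noteq> 0} \<le> card {(p, q)}"
    by (rule card_mono[rotated]) simp
  then show ?thesis
    using assms by (auto simp: elementary_quat_mat_def) (auto simp: transvection_def one_with_row_index)
qed

text \<open>Existence needs the value at every elementary matrix, not only at the chosen generators; a
  single off-diagonal entry in row \<open>p\<close> makes the matrix a transvection in that row.\<close>

lemma elementary_cases: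
  assumes E: "elementary_quat_mat n E"
  obtains "E = 1\<^sub>m n" | p b where "p < n" "b p = 1" "E = one_with_row n p b"
proof -
  let ?S = "{(i, j). i < n \<and> j < n \<and> i \<noteq> j \<and> E $$ (i, j) \<noteq> 0}"
  have carr: "E \<in> carrier_mat n n" and diag: "\<And>i. i < n \<Longrightarrow> E $$ (i, i) = 1" and card: "card ?S \<le> 1"
    using E by (auto simp: elementary_quat_mat_def)
  have fin: "finite ?S"
    by (rule finite_subset[of _ "{..<n} \<times> {..<n}"]) auto
  show thesis
  proof (cases "?S = {}")
    case True
    then have "E = 1\<^sub>m n"
      by (intro eq_matI) (use carr diag in auto)
    then show thesis by (rule that(1))
  next
    case False
    then obtain p q where pq: "(p, q) \<in> ?S" by auto
    then have p: "p < n" by simp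
    have off: "E $$ (i, j) = 0" if "i < n" "j < n" "i \<noteq> j" "i \<noteq> p" for i j
    proof (rule ccontr)
      assume "E $$ (i, j) \<noteq> 0"
      with that have "(i, j) \<in> ?S" by simp
      with pq card fin have "(i, j) = (p, q)"
        by (auto simp only: card_le_Suc0_iff_eq One_nat_def)
      with that show False by simp
    qed
    have "E = one_with_row n p (\<lambda>j. if j < n then E $$ (p, j) else 0)"
      by (rule eq_matI) (use carr diag off p in \<open>auto simp: one_with_row_index\<close>)
    with p diag show thesis by (intro that(2)) auto
  qed
qed

text \<open>A nonzero real determinant provides only a real inverse. That there is a quaternionic one
  comes from elimination: as the determinant is multiplicative, none of the factors of \<open>X\<close> is
  singular, and transvections and nonsingular diagonal matrices have explicit inverses.\<close>

lemma quat_GL_iff_real_det_root: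
  assumes X: "X \<in> carrier_mat n n"
  shows "X \<in> carrier (quat_GL n) \<longleftrightarrow> real_det_root X \<noteq> 0"
proof
  show "real_det_root X \<noteq> 0" if "X \<in> carrier (quat_GL n)"
    using real_det_root_quat_GL[OF that] by simp
next
  assume nz: "real_det_root X \<noteq> 0"
  have "X \<in> elimination_products n"
    using X by (simp add: carrier_mat_eq_elimination_products)
  then show "X \<in> carrier (quat_GL n)"
    using nz
  proof induction
    case (transvection p q a)
    then show ?case
      by (auto simp: transvection_def intro!: one_with_row_unit_in_quat_GL)
  next
    case (diagonal X)
    then have "(\<Prod>i<n. norm (X $$ (i, i))) \<noteq> 0"
      by (simp add: real_det_root_diagonal)
    then show ?case
      using diagonal by (intro diagonal_in_quat_GL) auto
  next
    case (mult X Y)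
    have "real_det_root (X * Y) = real_det_root X * real_det_root Y"
      using mult.hyps by (intro real_det_root_mult elimination_products_carrier)
    with mult show ?case
      by (auto intro: mult_in_quat_GL)
  qed
qed

text \<open>Uniqueness: the defining properties fix the values on the factors of an elimination product,
  and all factors of an invertible product are invertible.\<close>

lemma is_dieudonne_hom_imp_real_det_root:
  assumes f: "is_dieudonne_hom n f" and X: "X \<in> carrier (quat_GL n)"
  shows "f X = real_det_root X"
proof -
  have "X \<in> elimination_products n"
    using X by (simp add: carrier_mat_eq_elimination_products carrier_quat_GL)
  then show ?thesis
    using X
  proof induction
    case (transvection p q a)
    then have "real_det_root (transvection n p q a) = 1"
      by (auto simp: transvection_def intro!: real_det_root_one_with_row_unit)
    then show ?case
      using f elementary_transvection[of p n q a] transvection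
      by (simp add: is_dieudonne_hom_def)
  next
    case (diagonal X)
    then show ?case
      using f by (simp add: is_dieudonne_hom_def real_det_root_diagonal)
  next
    case (mult X Y)
    have carr: "X \<in> carrier_mat n n" "Y \<in> carrier_mat n n"
      using mult.hyps by (auto intro: elimination_products_carrier)
    have XY: "real_det_root (X * Y) = real_det_root X * real_det_root Y"
      by (rule real_det_root_mult[OF carr])
    moreover have "real_det_root (X * Y) \<noteq> 0"
      using mult.prems carr quat_GL_iff_real_det_root[of "X * Y" n] by simp
    ultimately have GL: "X \<in> carrier (quat_GL n)" "Y \<in> carrier (quat_GL n)"
      using carr by (auto simp: quat_GL_iff_real_det_root)
    then have "f (X * Y) = f X * f Y"
      using f hom_mult[of f "quat_GL n" pos_reals X Y]
      by (simp add: is_dieudonne_hom_def quat_GL_mult pos_reals_simps)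
    then show ?case
      using mult.IH GL by (simp add: XY)
  qed
qed

lemma is_dieudonne_hom_real_det_root:
  "is_dieudonne_hom n (restrict real_det_root (carrier (quat_GL n)))"
  unfolding is_dieudonne_hom_def
proof (intro conjI allI ballI impI)
  let ?f = "restrict real_det_root (carrier (quat_GL n))"
  show "?f \<in> hom (quat_GL n) pos_reals"
  proof (rule homI)
    fix X assume "X \<in> carrier (quat_GL n)"
    then show "?f X \<in> carrier pos_reals"
      by (simp add: pos_reals_simps real_det_root_quat_GL)
  next
    fix X Y assume XY: "X \<in> carrier (quat_GL n)" "Y \<in> carrier (quat_GL n)"
    then have "real_det_root (X * Y) = real_det_root X * real_det_root Y"
      by (intro real_det_root_mult) (auto simp: carrier_quat_GL)
    with XY show "?f (X \<otimes>\<^bsub>quat_GL n\<^esub> Y) = ?f X \<otimes>\<^bsub>pos_reals\<^esub> ?f Y"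
      by (simp add: quat_GL_mult pos_reals_simps mult_in_quat_GL)
  qed
  show "?f \<in> extensional (carrier (quat_GL n))" by simp
  show "?f E = 1" if "elementary_quat_mat n E" for E
    using that
  proof (cases rule: elementary_cases)
    case 1
    then show ?thesis
      by (simp add: quat_GL_iff_real_det_root real_det_root_one)
  next
    case (2 p b)
    then show ?thesis
      by (simp add: one_with_row_unit_in_quat_GL real_det_root_one_with_row_unit)
  qed
  show "?f X = (\<Prod>i<n. norm (X $$ (i, i)))"
    if "X \<in> carrier (quat_GL n)" "diagonal_mat X" for X
    using that by (simp add: real_det_root_diagonal carrier_quat_GL)
qed

lemma is_dieudonne_hom_unique:
  assumes "is_dieudonne_hom n f"
  shows "f = restrict real_det_root (carrier (quat_GL n))"
proof
  fix X
  show "f X = restrict real_det_root (carrier (quat_GL n)) X"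
  proof (cases "X \<in> carrier (quat_GL n)")
    case True
    then show ?thesis
      using is_dieudonne_hom_imp_real_det_root[OF assms] by simp
  next
    case False
    then show ?thesis
      using assms by (auto simp: is_dieudonne_hom_def extensional_def)
  qed
qed

text \<open>From here on the Dieudonne determinant, singular matrices included, is handled through the
  real determinant alone.\<close>

theorem dieudonne_det_eq_real_det_root:
  assumes "X \<in> carrier_mat n n"
  shows "dieudonne_det X = real_det_root X"
proof -
  have "dieudonne_hom n = restrict real_det_root (carrier (quat_GL n))"
    unfolding dieudonne_hom_def
    using is_dieudonne_hom_real_det_root is_dieudonne_hom_unique by (rule the_equality)
  then show ?thesis
    using assms quat_GL_iff_real_det_root[OF assms] by (auto simp: dieudonne_det_def)
qed

section \<open>Cramer's rule for the Dieudonne determinant\<close>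

lemma abs_det_eq_mat_delete:
  fixes A :: "real mat"
  assumes A: "A \<in> carrier_mat n n" and p: "p < n" and q: "q < n"
    and row: "\<And>j. j < n \<Longrightarrow> A $$ (p, j) = (if j = q then 1 else 0)"
  shows "\<bar>det A\<bar> = \<bar>det (mat_delete A p q)\<bar>"
proof -
  have "det A = (\<Sum>j<n. A $$ (p, j) * cofactor A p j)"
    by (rule laplace_expansion_row[OF A p])
  also have "\<dots> = (\<Sum>j<n. if j = q then cofactor A p q else 0)"
    using row by (intro sum.cong) auto
  also have "\<dots> = cofactor A p q"
    using q by simp
  finally show ?thesis
    by (simp add: cofactor_def abs_mult power_abs)
qed

text \<open>A row of \<open>X\<close> equal to the \<open>q\<close>-th unit vector becomes four real rows that are unit
  vectors with their ones in a common \<open>4 \<times> 4\<close> block. Four real Laplace expansions along these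
  rows, each with a single nonzero term, remove exactly that block of rows and columns.\<close>

lemma real_det_root_mat_delete:
  assumes X: "X \<in> carrier_mat n n" and p: "p < n" and q: "q < n"
    and row: "\<And>j. j < n \<Longrightarrow> X $$ (p, j) = (if j = q then 1 else 0)"
  shows "real_det_root (mat_delete X p q) = real_det_root X"
proof -
  \<comment> \<open>\<open>R k\<close> is the real matrix without the first \<open>k\<close> rows and columns of the block.\<close>
  define R where "R = (\<lambda>k. mat (n * 4 - k) (n * 4 - k) (\<lambda>(r, s).
    real_mat X $$ (if r < p * 4 then r else r + k, if s < q * 4 then s else s + k)))"
  have R_carrier: "R k \<in> carrier_mat (n * 4 - k) (n * 4 - k)" for k
    by (simp add: R_def)
  have step: "\<bar>det (R k)\<bar> = \<bar>det (R (Suc k))\<bar>" if k: "k < 4" for k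
  proof -
    have "\<bar>det (R k)\<bar> = \<bar>det (mat_delete (R k) (p * 4) (q * 4))\<bar>"
    proof (rule abs_det_eq_mat_delete[OF R_carrier])
      show "p * 4 < n * 4 - k" "q * 4 < n * 4 - k" using p q k by auto
      fix s assume s: "s < n * 4 - k"
      define t where "t = (if s < q * 4 then s else s + k)"
      have t: "t < n * 4" using s by (auto simp: t_def)
      then have "t div 4 < n" by auto
      have "R k $$ (p * 4, s) = real_mat X $$ (p * 4 + k, t)"
        using p k s by (auto simp: R_def t_def)
      also have "\<dots> = left_mult_entry (X $$ (p, t div 4)) k (t mod 4)"
        using real_mat_index[OF X, of "p * 4 + k" t] p k t by simp
      also have "\<dots> = (if t div 4 = q \<and> t mod 4 = k then 1 else 0)"
        using row[OF \<open>t div 4 < n\<close>] k by (auto simp: left_mult_entry_1)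
      also have "t div 4 = q \<and> t mod 4 = k \<longleftrightarrow> t = q * 4 + k"
        using k by auto
      also have "\<dots> \<longleftrightarrow> s = q * 4"
        by (auto simp: t_def)
      finally show "R k $$ (p * 4, s) = (if s = q * 4 then 1 else 0)" .
    qed
    also have "mat_delete (R k) (p * 4) (q * 4) = R (Suc k)"
      by (rule eq_matI) (auto simp: mat_delete_def R_def)
    finally show ?thesis .
  qed
  have "real_mat X = R 0"
    using X by (intro eq_matI) (auto simp: R_def)
  then have "\<bar>det (real_mat X)\<bar> = \<bar>det (R 0)\<bar>" by simp
  also have "\<dots> = \<bar>det (R 4)\<bar>"
    using step[of 0] step[of 1] step[of 2] step[of 3] by (simp add: eval_nat_numeral)
  also have "R 4 = real_mat (mat_delete X p q)"
  proof (rule eq_matI)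
    have M: "mat_delete X p q \<in> carrier_mat (n - 1) (n - 1)"
      using X by (rule mat_delete_carrier)
    fix r s assume "r < dim_row (real_mat (mat_delete X p q))" "s < dim_col (real_mat (mat_delete X p q))"
    then have rs: "r < (n - 1) * 4" "s < (n - 1) * 4" using M by auto
    then have ij: "r div 4 < n - 1" "s div 4 < n - 1" by auto
    define r' s' where "r' = (if r < p * 4 then r else r + 4)" and "s' = (if s < q * 4 then s else s + 4)"
    have rs': "r' < n * 4" "s' < n * 4"
      using rs by (auto simp: r'_def s'_def)
    have div_mod: "r' div 4 = (if r div 4 < p then r div 4 else Suc (r div 4))" "r' mod 4 = r mod 4"
      "s' div 4 = (if s div 4 < q then s div 4 else Suc (s div 4))" "s' mod 4 = s mod 4"
      by (auto simp: r'_def s'_def)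
    have "R 4 $$ (r, s) = real_mat X $$ (r', s')"
      using rs by (simp add: R_def r'_def s'_def)
    also have "\<dots> = left_mult_entry (X $$ (r' div 4, s' div 4)) (r' mod 4) (s' mod 4)"
      by (rule real_mat_index[OF X rs'])
    also have "X $$ (r' div 4, s' div 4) = mat_delete X p q $$ (r div 4, s div 4)"
      unfolding div_mod using X ij by (simp add: mat_delete_def)
    also have "left_mult_entry (mat_delete X p q $$ (r div 4, s div 4)) (r' mod 4) (s' mod 4) =
        real_mat (mat_delete X p q) $$ (r, s)"
      unfolding div_mod by (rule real_mat_index[OF M rs, symmetric])
    finally show "R 4 $$ (r, s) = real_mat (mat_delete X p q) $$ (r, s)" .
  qed (use X in \<open>auto simp: R_def\<close>)
  finally show ?thesis
    by (simp add: real_det_root_def)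
qed

text \<open>Replace row \<open>p\<close> of \<open>A\<close> by the \<open>q\<close>-th unit vector. This does not change the minor, and
  right multiplication by the inverse \<open>B\<close> turns the new matrix into the identity with row \<open>p\<close>
  replaced by row \<open>q\<close> of \<open>B\<close>, whose determinant is the absolute value of its diagonal entry in
  row \<open>p\<close>.\<close>

lemma dieudonne_det_cramer:
  assumes A: "A \<in> carrier_mat n n" and B: "B \<in> carrier_mat n n"
    and AB: "A * B = 1\<^sub>m n" and p: "p < n" and q: "q < n"
  shows "dieudonne_det (mat_delete A p q) = norm (B $$ (q, p)) * dieudonne_det A"
proof -
  define R where "R = mat n n (\<lambda>(i, j). if i = p then if j = q then 1 else 0 else A $$ (i, j))"
  have R: "R \<in> carrier_mat n n" by (simp add: R_def)
  have R_index: "R $$ (i, j) = (if i = p then if j = q then 1 else 0 else A $$ (i, j))"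
    if "i < n" "j < n" for i j
    using that by (simp add: R_def)
  have "mat_delete R p q = mat_delete A p q"
    using A by (intro eq_matI) (auto simp: R_def mat_delete_def)
  then have "real_det_root (mat_delete A p q) = real_det_root R"
    using real_det_root_mat_delete[OF R p q] p by (simp add: R_index)
  moreover have "R * B = one_with_row n p (\<lambda>j. B $$ (q, j))"
  proof (rule eq_matI)
    fix i j assume "i < dim_row (one_with_row n p (\<lambda>j. B $$ (q, j)))"
      "j < dim_col (one_with_row n p (\<lambda>j. B $$ (q, j)))"
    then have ij: "i < n" "j < n" by auto
    have "(R * B) $$ (i, j) = (\<Sum>k<n. R $$ (i, k) * B $$ (k, j))"
      by (rule mult_mat_index[OF R B ij])
    also have "\<dots> = (if i = p then B $$ (q, j) else (A * B) $$ (i, j))"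
    proof (cases "i = p")
      case True
      have "(\<Sum>k<n. R $$ (i, k) * B $$ (k, j)) = (\<Sum>k<n. if k = q then B $$ (q, j) else 0)"
        using ij True by (intro sum.cong) (auto simp: R_index)
      with True q show ?thesis by simp
    next
      case False
      then show ?thesis
        unfolding mult_mat_index[OF A B ij] using ij by (auto simp: R_index intro!: sum.cong)
    qed
    finally show "(R * B) $$ (i, j) = one_with_row n p (\<lambda>j. B $$ (q, j)) $$ (i, j)"
      using ij by (simp add: AB one_with_row_index)
  qed (use R B in auto)
  then have "real_det_root R * real_det_root B = norm (B $$ (q, p))"
    using real_det_root_mult[OF R B] p by (simp add: real_det_root_one_with_row)
  moreover have "real_det_root A * real_det_root B = 1"
    using real_det_root_mult[OF A B] AB by (simp add: real_det_root_one)
  ultimately have "real_det_root (mat_delete A p q) = norm (B $$ (q, p)) * real_det_root A"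
    by (metis mult.assoc mult.commute mult.right_neutral)
  then show ?thesis
    by (simp only: dieudonne_det_eq_real_det_root[OF A]
      dieudonne_det_eq_real_det_root[OF mat_delete_carrier[OF A]])
qed

text \<open>By Cramer's rule both sums are \<open>D(A)\<close> times the sum of the absolute values of the terms
  of \<open>(A B)\<^bsub>pp\<^esub> = 1\<close>, respectively \<open>(B A)\<^bsub>pp\<^esub> = 1\<close>, where \<open>B\<close> is the inverse of \<open>A\<close>.
  The triangle inequality bounds these sums below by \<open>1\<close>.\<close>

theorem dieudonne_det_le_expansion:
  assumes A: "A \<in> carrier_mat n n" and p: "p < n"
  shows "dieudonne_det A \<le> (\<Sum>i<n. norm (A $$ (p, i)) * dieudonne_det (mat_delete A p i))"
    and "dieudonne_det A \<le> (\<Sum>i<n. norm (A $$ (i, p)) * dieudonne_det (mat_delete A i p))"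
proof -
  have nonneg: "dieudonne_det X \<ge> 0" if "X \<in> carrier_mat m m" for X m
    using that by (simp add: dieudonne_det_eq_real_det_root real_det_root_nonneg)
  have "dieudonne_det A \<le> (\<Sum>i<n. norm (A $$ (p, i)) * dieudonne_det (mat_delete A p i)) \<and>
    dieudonne_det A \<le> (\<Sum>i<n. norm (A $$ (i, p)) * dieudonne_det (mat_delete A i p))"
  proof (cases "A \<in> carrier (quat_GL n)")
    case False
    then have "dieudonne_det A = 0"
      using A by (auto simp: dieudonne_det_def)
    moreover have "dieudonne_det (mat_delete A i j) \<ge> 0" for i j
      by (rule nonneg[OF mat_delete_carrier[OF A]])
    ultimately show ?thesis
      by (simp add: sum_nonneg)
  next
    case True
    then obtain B where B: "B \<in> carrier_mat n n" and AB: "A * B = 1\<^sub>m n" and BA: "B * A = 1\<^sub>m n"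
      by (auto simp: carrier_quat_GL)
    have det: "dieudonne_det (mat_delete A i j) = norm (B $$ (j, i)) * dieudonne_det A"
      if "i < n" "j < n" for i j
      using dieudonne_det_cramer[OF A B AB that] .
    have "1 = norm (\<Sum>i<n. A $$ (p, i) * B $$ (i, p))"
      using mult_mat_index[OF A B p p] p by (simp add: AB)
    also have "\<dots> \<le> (\<Sum>i<n. norm (A $$ (p, i)) * norm (B $$ (i, p)))"
      by (rule sum_norm_le) (simp add: norm_mult)
    finally have row: "1 \<le> (\<Sum>i<n. norm (A $$ (p, i)) * norm (B $$ (i, p)))" .
    have "1 = norm (\<Sum>i<n. B $$ (p, i) * A $$ (i, p))"
      using mult_mat_index[OF B A p p] p by (simp add: BA)
    also have "\<dots> \<le> (\<Sum>i<n. norm (A $$ (i, p)) * norm (B $$ (p, i)))"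
      by (rule sum_norm_le) (simp add: norm_mult)
    finally have col: "1 \<le> (\<Sum>i<n. norm (A $$ (i, p)) * norm (B $$ (p, i)))" .
    show ?thesis
      using mult_right_mono[OF row nonneg[OF A]] mult_right_mono[OF col nonneg[OF A]] p
      by (simp add: det sum_distrib_right mult.assoc)
  qed
  then show "dieudonne_det A \<le> (\<Sum>i<n. norm (A $$ (p, i)) * dieudonne_det (mat_delete A p i))"
    and "dieudonne_det A \<le> (\<Sum>i<n. norm (A $$ (i, p)) * dieudonne_det (mat_delete A i p))"
    by auto
qed

theorem theorem1p2p5:
  fixes A :: "quat mat" and n :: nat
  assumes "A \<in> carrier_mat n n" and "n \<ge> 1"
  shows "dieudonne_det A \<le>
           (\<Sum>i<n. norm (A $$ (0, i)) * dieudonne_det (mat_delete A 0 i)) \<and>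
         (\<forall>p<n. dieudonne_det A \<le>
                  (\<Sum>i<n. norm (A $$ (p, i)) * dieudonne_det (mat_delete A p i)) \<and>
                dieudonne_det A \<le>
                  (\<Sum>i<n. norm (A $$ (i, p)) * dieudonne_det (mat_delete A i p)))"
  using dieudonne_det_le_expansion[OF assms(1)] assms(2) by auto

end
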